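(* Let $\mathcal{T}$ be a tree with vertex set $V(\mathcal{T})$ and edge set $E(\mathcal{T})$ such that $2\le \deg(v)<\infty$ for all $v\in V(\mathcal{T})$. Let $A$ be a commutative ring, $M$ an $A$-module, and $w\colon V(\mathcal{T})\to A^\times$ a map (a weight function). Then the Laplacian of weight $w$, $$\Delta_w\colon \mathrm{Maps}(E(\mathcal{T}),M)\to \mathrm{Maps}(V(\mathcal{T}),M),\qquad \Delta_w(f)(v)=w(v)\sum_{e\in E_v} f(e),$$ where $E_v=\{e\in E(\mathcal{T}) : v\in e\}$, is surjective.
   Context: A tree is a simple graph (edges are unordered pairs $\{v,w\}$ of distinct vertices) that is non-empty, connected and acyclic. $\deg(v)$ is the number of neighbours of $v$. For a set $X$, $\mathrm{Maps}(X,M)$ denotes the $A$-module of all maps $X\to M$. Commutative rings have a unit $1$, and $A^\times$ is the group of units of $A$. *)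

theory Defs
  imports "HOL-Algebra.Module" "HOL-Library.FuncSet"
begin

section \<open>Undirected trees\<close>

locale simple_graph =
  fixes V :: "'v set" and E :: "'v set set"
  assumes edge_doubleton: "e \<in> E \<Longrightarrow> \<exists>x\<in>V. \<exists>y\<in>V. x \<noteq> y \<and> e = {x, y}"

definition neighbours :: "'v set set \<Rightarrow> 'v \<Rightarrow> 'v set" where
  "neighbours E v = {x. {v, x} \<in> E}"

text \<open>As with \<^const>\<open>card\<close>, this is 0 when \<^term>\<open>v\<close> has infinitely many neighbours;
  finiteness of the degree is \<^prop>\<open>finite (neighbours E v)\<close>.\<close>
definition degree :: "'v set set \<Rightarrow> 'v \<Rightarrow> nat" where
  "degree E v = card (neighbours E v)"

definition walk :: "'v set \<Rightarrow> 'v set set \<Rightarrow> 'v list \<Rightarrow> bool" where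
  "walk V E p \<longleftrightarrow> p \<noteq> [] \<and> set p \<subseteq> V \<and> successively (\<lambda>x y. {x, y} \<in> E) p"

text \<open>A cycle is given by the list of its pairwise distinct vertices, without repeating the
  first one at the end; length at least 3 excludes traversing a single edge back and forth.\<close>
definition cycle :: "'v set \<Rightarrow> 'v set set \<Rightarrow> 'v list \<Rightarrow> bool" where
  "cycle V E p \<longleftrightarrow> walk V E p \<and> distinct p \<and> 3 \<le> length p \<and> {last p, hd p} \<in> E"

text \<open>\<^term>\<open>V\<close> and \<^term>\<open>E\<close> may be infinite.\<close>
locale tree = simple_graph +
  assumes nonempty: "V \<noteq> {}"
    and connected: "\<lbrakk>x \<in> V; y \<in> V\<rbrakk> \<Longrightarrow> \<exists>p. walk V E p \<and> hd p = x \<and> last p = y"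
    and acyclic: "\<not> cycle V E p"


section \<open>Modules of maps and the weighted Laplacian\<close>

text \<open>Maps out of \<^term>\<open>X\<close> are represented by functions that are \<^const>\<open>undefined\<close> outside
  \<^term>\<open>X\<close>, so that each map has exactly one representative. The record type of modules
  inherits the fields \<^const>\<open>mult\<close> and \<^const>\<open>one\<close> from rings; they play no role.\<close>
definition Maps :: "'x set \<Rightarrow> ('a, 'm, 'c) module_scheme \<Rightarrow> ('a, 'x \<Rightarrow> 'm) module" where
  "Maps X M =
    \<lparr>carrier = X \<rightarrow>\<^sub>E carrier M,
     mult = (\<lambda>f g. \<lambda>x\<in>X. f x \<otimes>\<^bsub>M\<^esub> g x),
     one = (\<lambda>x\<in>X. \<one>\<^bsub>M\<^esub>),
     zero = (\<lambda>x\<in>X. \<zero>\<^bsub>M\<^esub>),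
     add = (\<lambda>f g. \<lambda>x\<in>X. f x \<oplus>\<^bsub>M\<^esub> g x),
     smult = (\<lambda>a f. \<lambda>x\<in>X. a \<odot>\<^bsub>M\<^esub> f x)\<rparr>"

lemma Maps_sel:
  "carrier (Maps X M) = X \<rightarrow>\<^sub>E carrier M"
  "zero (Maps X M) = (\<lambda>x\<in>X. \<zero>\<^bsub>M\<^esub>)"
  "add (Maps X M) f g = (\<lambda>x\<in>X. f x \<oplus>\<^bsub>M\<^esub> g x)"
  "smult (Maps X M) a f = (\<lambda>x\<in>X. a \<odot>\<^bsub>M\<^esub> f x)"
  by (simp_all add: Maps_def)

lemma module_Maps:
  assumes "module A M"
  shows "module A (Maps X M)"
proof -
  interpret module A M by fact
  show ?thesis
  proof (rule moduleI)
    show "cring A" by (rule R.is_cring)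
    show "abelian_group (Maps X M)"
    proof (rule abelian_groupI)
      fix f assume f: "f \<in> carrier (Maps X M)"
      show "\<exists>g\<in>carrier (Maps X M). g \<oplus>\<^bsub>Maps X M\<^esub> f = \<zero>\<^bsub>Maps X M\<^esub>"
      proof
        show "(\<lambda>x\<in>X. \<ominus>\<^bsub>M\<^esub> f x) \<in> carrier (Maps X M)"
          using f by (auto simp: Maps_sel PiE_iff)
        show "(\<lambda>x\<in>X. \<ominus>\<^bsub>M\<^esub> f x) \<oplus>\<^bsub>Maps X M\<^esub> f = \<zero>\<^bsub>Maps X M\<^esub>"
          using f by (auto simp: Maps_sel PiE_iff M.l_neg intro!: restrict_ext)
      qed
    qed (auto simp: Maps_sel PiE_iff M.a_ac restrict_def extensional_def fun_eq_iff)
  qed (auto simp: Maps_sel PiE_iff smult_l_distr smult_r_distr smult_assoc1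
         restrict_def extensional_def fun_eq_iff)
qed

text \<open>\<^const>\<open>finsum\<close> is only meaningful for finite index sets; the set of edges at \<^term>\<open>v\<close>
  is finite whenever \<^term>\<open>v\<close> has finite degree.\<close>
definition laplacian ::
  "'v set \<Rightarrow> 'v set set \<Rightarrow> ('a, 'm, 'c) module_scheme \<Rightarrow> ('v \<Rightarrow> 'a) \<Rightarrow> ('v set \<Rightarrow> 'm) \<Rightarrow> 'v \<Rightarrow> 'm"
  where
  "laplacian V E M w f = (\<lambda>v\<in>V. w v \<odot>\<^bsub>M\<^esub> (\<Oplus>\<^bsub>M\<^esub>e\<in>{e \<in> E. v \<in> e}. f e))"

end

theory Submission
  imports Defs
begin

text \<open>Root the tree. Since every degree is at least 2, every vertex \<open>v\<close> has a child \<open>c v\<close>.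
  Define \<open>f\<close> by recursion on the depth: on the edges from \<open>v\<close> to its children it vanishes, except
  that on the edge to \<open>c v\<close> it takes the value needed to make the sum at \<open>v\<close> correct, given the
  value on the edge from \<open>v\<close> to its parent.\<close>

context simple_graph
begin

lemma edgeD:
  assumes "{x, y} \<in> E"
  shows "x \<in> V" "y \<in> V" "x \<noteq> y"
  using edge_doubleton[OF assms] by (auto simp: doubleton_eq_iff)

lemma edges_at_eq: "{e \<in> E. v \<in> e} = (\<lambda>x. {v, x}) ` neighbours E v"
  using edge_doubleton by (fastforce simp: neighbours_def insert_commute)

text \<open>The path ascends from both ends until the two branches meet.\<close>
lemma path_between_same_depth:
  fixes d :: "'v \<Rightarrow> nat"
  assumes parent: "\<And>v n. v \<in> V \<Longrightarrow> d v = Suc n \<Longrightarrow> \<exists>u. {u, v} \<in> E \<and> d u = n"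
    and root: "\<And>u v. u \<in> V \<Longrightarrow> v \<in> V \<Longrightarrow> d u = 0 \<Longrightarrow> d v = 0 \<Longrightarrow> u = v"
    and "x \<in> V" "y \<in> V" "x \<noteq> y" "d x = n" "d y = n"
  shows "\<exists>q. walk V E q \<and> distinct q \<and> 3 \<le> length q \<and> hd q = x \<and> last q = y
           \<and> (\<forall>z\<in>set q. d z \<le> n)"
  using assms(3-)
proof (induction n arbitrary: x y)
  case 0
  then show ?case using root by blast
next
  case (Suc n)
  obtain x' where x': "{x', x} \<in> E" "d x' = n" using parent Suc.prems by blast
  obtain y' where y': "{y', y} \<in> E" "d y' = n" using parent Suc.prems by blast
  show ?case
  proof (cases "x' = y'")
    case True
    have "walk V E [x, x', y] \<and> distinct [x, x', y]"
      using x' y' True Suc.prems edgeD by (auto simp: walk_def insert_commute)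
    then show ?thesis
      using x' Suc.prems by (intro exI[of _ "[x, x', y]"]) auto
  next
    case False
    obtain q where q: "walk V E q" "distinct q" "3 \<le> length q" "hd q = x'" "last q = y'"
        "\<forall>z\<in>set q. d z \<le> n"
      using Suc.IH[OF edgeD(1)[OF x'(1)] edgeD(1)[OF y'(1)] False x'(2) y'(2)] by blast
    \<comment> \<open>The depth bound carried through the induction keeps \<open>x\<close> and
      \<open>y\<close>, which lie one level deeper, off the inner path.\<close>
    have "x \<notin> set q" "y \<notin> set q" using q(6) Suc.prems by auto
    moreover have "walk V E (x # q @ [y])"
      using q x' y' Suc.prems
      by (auto simp: walk_def successively_append_iff successively_Cons insert_commute)
    ultimately show ?thesis
      using q Suc.prems by (intro exI[of _ "x # q @ [y]"]) (auto simp: le_Suc_eq)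
  qed
qed

end

text \<open>Take for \<open>d\<close> the distance from a root. An edge inside one level, or a
  vertex with two neighbours one level up, would turn the path between vertices of equal depth into
  a cycle.\<close>

lemma (in tree) exists_depth_parent:
  obtains d :: "'a \<Rightarrow> nat" and p :: "'a \<Rightarrow> 'a"
  where "\<And>x y. {x, y} \<in> E \<Longrightarrow> d y = Suc (d x) \<and> p y = x \<or> d x = Suc (d y) \<and> p x = y"
    and "\<And>v n. v \<in> V \<Longrightarrow> d v = Suc n \<Longrightarrow> {p v, v} \<in> E \<and> d (p v) = n"
proof -
  obtain r where r: "r \<in> V" using nonempty by blast
  define R where "R = {(x, y). {x, y} \<in> E}"
  define d where "d v = (LEAST n. (r, v) \<in> R ^^ n)" for v
  \<comment> \<open>Connectedness is needed in terms of powers of \<open>R\<close>, so that the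
    \<open>LEAST\<close> in \<open>d\<close> is attained on all of \<open>V\<close>.\<close>
  have walk_R: "(hd q, last q) \<in> R\<^sup>*" if "walk V E q" for q
    using that
  proof (induction q)
    case (Cons a q)
    show ?case
    proof (cases "q = []")
      case False
      then have "(a, hd q) \<in> R" "walk V E q"
        using Cons.prems by (auto simp: walk_def successively_Cons R_def)
      then show ?thesis using Cons.IH False by (auto intro: converse_rtrancl_into_rtrancl)
    qed simp
  qed (simp add: walk_def)
  have reach: "(r, v) \<in> R ^^ d v" if v: "v \<in> V" for v
  proof -
    have "(r, v) \<in> R\<^sup>*" using connected[OF r v] walk_R by blast
    then show ?thesis
      unfolding d_def by (metis LeastI_ex rtrancl_imp_relpow)
  qed
  have d_le: "d v \<le> n" if "(r, v) \<in> R ^^ n" for v n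
    unfolding d_def using that by (rule Least_le)
  have step: "d y \<le> Suc (d x)" if "{x, y} \<in> E" for x y
    using that reach[OF edgeD(1)[OF that]] by (intro d_le) (auto simp: R_def)
  have root: "u = v" if "u \<in> V" "v \<in> V" "d u = 0" "d v = 0" for u v
    using reach[OF that(1)] reach[OF that(2)] that by simp
  \<comment> \<open>The vertex preceding \<open>v\<close> on a shortest walk from \<open>r\<close>
    has depth exactly \<open>n\<close>: at most by minimality, at least by
    \<open>step\<close>.\<close>
  have parent: "\<exists>u. {u, v} \<in> E \<and> d u = n" if v: "v \<in> V" "d v = Suc n" for v n
  proof -
    obtain u where u: "(r, u) \<in> R ^^ n" "(u, v) \<in> R"
      using reach[OF v(1)] v(2) by auto
    then have "{u, v} \<in> E" by (simp add: R_def)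
    moreover have "d u = n" using d_le[OF u(1)] step[OF \<open>{u, v} \<in> E\<close>] v by simp
    ultimately show ?thesis by blast
  qed
  have path: "\<exists>q. walk V E q \<and> distinct q \<and> 3 \<le> length q \<and> hd q = x \<and> last q = y
      \<and> (\<forall>z\<in>set q. d z \<le> d x)" if "x \<in> V" "y \<in> V" "x \<noteq> y" "d x = d y" for x y
    by (rule path_between_same_depth[OF parent root]) (use that in auto)
  have neq: "d x \<noteq> d y" if e: "{x, y} \<in> E" for x y
  proof
    assume "d x = d y"
    then obtain q where "walk V E q" "distinct q" "3 \<le> length q" "hd q = x" "last q = y"
      using path edgeD[OF e] by blast
    then have "cycle V E q" using e by (simp add: cycle_def insert_commute)
    then show False using acyclic by blast
  qed
  have unique: "x = y" if e: "{x, z} \<in> E" "{y, z} \<in> E" "d z = Suc (d x)" "d z = Suc (d y)"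
    for x y z
  proof (rule ccontr)
    assume "x \<noteq> y"
    then obtain q where q: "walk V E q" "distinct q" "3 \<le> length q" "hd q = x" "last q = y"
        "\<forall>z\<in>set q. d z \<le> d x"
      using path edgeD(1)[OF e(1)] edgeD(1)[OF e(2)] e(3,4) by (metis Suc_inject)
    \<comment> \<open>The path stays at depth at most \<open>d x\<close>, so \<open>z\<close>, one
      level below, can be added to close it up.\<close>
    have "z \<notin> set q" using q(6) e(3) by auto
    then have "cycle V E (q @ [z])"
      using q e edgeD(2)[OF e(1)]
      by (auto simp: cycle_def walk_def successively_append_iff insert_commute)
    then show False using acyclic by blast
  qed
  \<comment> \<open>At the root no such \<open>u\<close> exists and \<open>p\<close> takes an
    arbitrary value; later arguments must allow for this.\<close>
  define p where "p v = (SOME u. {u, v} \<in> E \<and> d v = Suc (d u))" for v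
  have p: "p v = u" if "{u, v} \<in> E" "d v = Suc (d u)" for u v
    unfolding p_def by (rule some_equality) (use that unique in auto)
  show thesis
  proof (rule that)
    fix x y assume e: "{x, y} \<in> E"
    then have e': "{y, x} \<in> E" by (simp add: insert_commute)
    have "d y = Suc (d x) \<or> d x = Suc (d y)"
      using neq[OF e] step[OF e] step[OF e'] by linarith
    then show "d y = Suc (d x) \<and> p y = x \<or> d x = Suc (d y) \<and> p x = y"
      using p[OF e] p[OF e'] by blast
  next
    fix v n assume "v \<in> V" "d v = Suc n"
    then show "{p v, v} \<in> E \<and> d (p v) = n" using parent p by metis
  qed
qed

text \<open>This is surjectivity for the constant weight 1, to which the theorem reduces because
  each \<open>w v\<close> is invertible.\<close>

lemma (in tree) exists_edge_map_with_vertex_sums: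
  fixes M (structure)
  assumes deg: "\<And>v. v \<in> V \<Longrightarrow> finite (neighbours E v) \<and> 2 \<le> degree E v"
    and "abelian_group M"
    and m: "m \<in> V \<rightarrow> carrier M"
  obtains f where "f \<in> E \<rightarrow>\<^sub>E carrier M"
    and "\<And>v. v \<in> V \<Longrightarrow> (\<Oplus>e\<in>{e \<in> E. v \<in> e}. f e) = m v"
proof -
  interpret M: abelian_group M by fact
  obtain d :: "'a \<Rightarrow> nat" and p where
    dp: "\<And>x y. {x, y} \<in> E \<Longrightarrow> d y = Suc (d x) \<and> p y = x \<or> d x = Suc (d y) \<and> p x = y"
    and parent: "\<And>v n. v \<in> V \<Longrightarrow> d v = Suc n \<Longrightarrow> {p v, v} \<in> E \<and> d (p v) = n"
    by (rule exists_depth_parent) blast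
  have "\<exists>x. {v, x} \<in> E \<and> d x = Suc (d v) \<and> p x = v" if v: "v \<in> V" for v
  proof -
    \<comment> \<open>Two neighbours cannot both equal \<open>p v\<close>, and by \<open>dp\<close>
      a neighbour other than \<open>p v\<close> is a child.\<close>
    have "\<not> neighbours E v \<subseteq> {p v}"
      using deg[OF v] card_mono[of "{p v}" "neighbours E v"] by (auto simp: degree_def)
    then show ?thesis using dp by (fastforce simp: neighbours_def)
  qed
  then obtain c where c: "\<And>v. v \<in> V \<Longrightarrow> {v, c v} \<in> E \<and> d (c v) = Suc (d v) \<and> p (c v) = v"
    by metis
  \<comment> \<open>\<open>G n\<close> is meant for vertices of depth \<open>n\<close>. The
    resulting \<open>g v\<close> is the future value of \<open>f\<close> on the edge from
    \<open>p v\<close> down to \<open>v\<close>; at the root it is zero, as if there were a parent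
    edge with value zero.\<close>
  define G where "G = rec_nat (\<lambda>v. \<zero>)
    (\<lambda>n G v. if v = c (p v) then m (p v) \<ominus> G (p v) else \<zero>)"
  define g where "g v = G (d v) v" for v
  have g_root: "g v = \<zero>" if "d v = 0" for v
    using that by (simp add: g_def G_def)
  have g_child: "g v = (if v = c (p v) then m (p v) \<ominus> g (p v) else \<zero>)"
    if "v \<in> V" "d v = Suc n" for v n
    using parent[OF that] that(2) by (simp add: g_def G_def)
  have g_closed: "g v \<in> carrier M" if "v \<in> V" for v
    using that
  proof (induction "d v" arbitrary: v)
    case 0
    then show ?case by (simp add: g_root)
  next
    case (Suc n)
    then have "p v \<in> V" "d (p v) = n" using parent edgeD by metis+
    then show ?case using Suc g_child[of v n] m by (auto intro!: M.minus_closed)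
  qed
  \<comment> \<open>The deeper end of an edge, unique because the two ends have different
    depths.\<close>
  define lower where "lower e = (SOME x. x \<in> e \<and> (\<forall>y\<in>e. d y \<le> d x))" for e
  have lower: "lower {x, y} = y" if "d x < d y" for x y
    unfolding lower_def by (rule some_equality) (use that in auto)
  define f where "f = (\<lambda>e\<in>E. g (lower e))"
  have f: "f {v, x} = (if d v < d x then g x else g v)" if e: "{v, x} \<in> E" for v x
    using dp[OF e] lower[of v x] lower[of x v] e by (auto simp: f_def insert_commute)
  show thesis
  proof (rule that)
    have "f e \<in> carrier M" if "e \<in> E" for e
      using edge_doubleton[OF that] that f g_closed by (metis (no_types, lifting))
    then show "f \<in> E \<rightarrow>\<^sub>E carrier M" by (auto simp: f_def)
  next
    fix v assume v: "v \<in> V"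
    define N where "N = neighbours E v - {c v}"
    have fin: "finite N" and cN: "c v \<notin> N" and ins: "neighbours E v = insert (c v) N"
      using deg[OF v] c[OF v] by (auto simp: N_def neighbours_def)
    have closed: "f {v, x} \<in> carrier M" if "x \<in> neighbours E v" for x
      using that f[of v x] g_closed edgeD by (auto simp: neighbours_def)
    \<comment> \<open>Children other than \<open>c v\<close> carry zero, so only the parent edge can
      contribute. Should the arbitrary \<open>p v\<close> at the root happen to be a neighbour, the
      formula still holds since \<open>g v\<close> is zero there.\<close>
    have N_eq: "f {v, x} = (if p v = x then g v else \<zero>)" if x: "x \<in> N" for x
    proof -
      have e: "{v, x} \<in> E" using x by (simp add: N_def neighbours_def)
      consider "d x = Suc (d v)" "p x = v" | "d v = Suc (d x)" "p v = x"
        using dp[OF e] by blast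
      then show ?thesis
      proof cases
        case 1
        then have "g x = \<zero>" using g_child[OF edgeD(2)[OF e]] x cN by auto
        moreover have "p v \<noteq> x \<or> g v = \<zero>"
          using 1 g_root parent[OF v] by (cases "d v") force+
        ultimately show ?thesis using 1 f[OF e] by auto
      next
        case 2
        then show ?thesis using f[OF e] by simp
      qed
    qed
    have "(\<Oplus>x\<in>N. f {v, x}) = (\<Oplus>x\<in>N. if p v = x then g v else \<zero>)"
      using N_eq g_closed[OF v] by (intro M.finsum_cong') auto
    also have "\<dots> = g v"
    proof (cases "p v \<in> N")
      case True
      then show ?thesis
        using M.finsum_singleton[OF True fin, of "\<lambda>_. g v"] g_closed[OF v] by simp
    next
      case False
      \<comment> \<open>Only the root can occur here: elsewhere the parent is a neighbour, so it
        would have to be \<open>c v\<close>, which lies below \<open>v\<close>.\<close>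
      have "g v = \<zero>"
      proof (cases "d v")
        case (Suc n)
        have "p v \<in> neighbours E v"
          using parent[OF v Suc] by (simp add: neighbours_def insert_commute)
        then have "p v = c v" using False by (simp add: N_def)
        then show ?thesis using parent[OF v Suc] c[OF v] Suc by simp
      qed (simp add: g_root)
      then show ?thesis by (simp cong: if_cong)
    qed
    finally have N_sum: "(\<Oplus>x\<in>N. f {v, x}) = g v" .
    have fc: "f {v, c v} = m v \<ominus> g v"
      using c[OF v] f[of v "c v"] g_child[of "c v" "d v"] edgeD(2)[of v "c v"] by simp
    \<comment> \<open>Pass from edges at \<open>v\<close> to neighbours, then split off
      \<open>c v\<close>: the sum becomes \<open>m v\<close> minus \<open>g v\<close>, plus
      \<open>g v\<close>.\<close>
    have "inj_on (\<lambda>x. {v, x}) (neighbours E v)"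
      by (auto simp: inj_on_def doubleton_eq_iff)
    then have "(\<Oplus>e\<in>{e \<in> E. v \<in> e}. f e) = (\<Oplus>x\<in>neighbours E v. f {v, x})"
      unfolding edges_at_eq by (rule M.finsum_reindex[rotated]) (use closed in auto)
    also have "\<dots> = f {v, c v} \<oplus> (\<Oplus>x\<in>N. f {v, x})"
      unfolding ins by (rule M.finsum_insert) (use fin cN closed ins in auto)
    also have "\<dots> = m v"
      unfolding N_sum fc using funcset_mem[OF m v] g_closed[OF v]
      by (simp add: a_minus_def M.a_assoc M.l_neg)
    finally show "(\<Oplus>e\<in>{e \<in> E. v \<in> e}. f e) = m v" .
  qed
qed

theorem proposition4p4:
  fixes V :: "'v set" and E :: "'v set set"
    and A :: "('a, 'r) ring_scheme" and M :: "('a, 'm, 'c) module_scheme"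
    and w :: "'v \<Rightarrow> 'a"
  assumes "tree V E"
    and "\<And>v. v \<in> V \<Longrightarrow> finite (neighbours E v) \<and> 2 \<le> degree E v"
    and "cring A" and "module A M"
    and "w \<in> V \<rightarrow> Units A"
  shows "laplacian V E M w ` carrier (Maps E M) = carrier (Maps V M)"
proof -
  interpret tree V E by fact
  interpret module A M by fact
  have w: "w v \<in> Units A" "w v \<in> carrier A" "inv\<^bsub>A\<^esub> w v \<in> carrier A" if "v \<in> V" for v
    using that assms(5) by auto
  have "laplacian V E M w f \<in> V \<rightarrow>\<^sub>E carrier M" if "f \<in> E \<rightarrow>\<^sub>E carrier M" for f
    using that w by (auto simp: laplacian_def intro!: smult_closed M.finsum_closed)
  moreover have "\<exists>f\<in>E \<rightarrow>\<^sub>E carrier M. h = laplacian V E M w f" if h: "h \<in> V \<rightarrow>\<^sub>E carrier M" for h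
  proof -
    have h_closed: "h v \<in> carrier M" if "v \<in> V" for v using h that by auto
    \<comment> \<open>Prescribe the values of \<open>h\<close> divided by the weight, so that
      multiplying by \<open>w v\<close> restores \<open>h v\<close>.\<close>
    obtain f where f: "f \<in> E \<rightarrow>\<^sub>E carrier M"
      "\<And>v. v \<in> V \<Longrightarrow> (\<Oplus>\<^bsub>M\<^esub>e\<in>{e \<in> E. v \<in> e}. f e) = inv\<^bsub>A\<^esub> w v \<odot>\<^bsub>M\<^esub> h v"
      using exists_edge_map_with_vertex_sums[of M "\<lambda>v. inv\<^bsub>A\<^esub> w v \<odot>\<^bsub>M\<^esub> h v"] assms(2)
        M.abelian_group_axioms w h_closed by auto
    have "h v = laplacian V E M w f v" for v
    proof (cases "v \<in> V")
      case True
      then show ?thesis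
        using f(2) w h_closed by (simp add: laplacian_def smult_assoc1[symmetric])
    next
      \<comment> \<open>Outside \<open>V\<close> both maps are \<open>undefined\<close>, which gives
        equality as functions.\<close>
      case False
      then show ?thesis using h by (auto simp: laplacian_def)
    qed
    then show ?thesis using f(1) by blast
  qed
  ultimately show ?thesis unfolding Maps_sel by blast
qed

end
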